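(* Let $d,m$ be positive integers, let $f:\mathbb{R}^d\to\mathbb{R}^d$ and $g_k:\mathbb{R}^d\to\mathbb{R}^d$, $k\in\{1,\dots,m\}$, be continuously differentiable, and let $\kappa=(\kappa_1,\dots,\kappa_m):\mathbb{R}^d\to\mathbb{R}^m$ be a feedback such that: (1) the nominal closed-loop system $\dot x(t)=f(x(t))+\sum_{k=1}^m g_k(x(t))\kappa_k(x(t))$ has a hyperbolic and locally asymptotically stable equilibrium at $0\in\mathbb{R}^d$; (2) the map $\xi\mapsto f(\xi)+\sum_{k=1}^m g_k(\xi)\kappa_k(\xi)$ is twice continuously differentiable in a neighborhood of $0$; (3) $f(0)=0$ and $\kappa_k(0)=0$ for each $k\in\{1,\dots,m\}$. For $\tau>0$ and $t_0\ge 0$ consider the round-robin scheduled system with constant switching time $\tau$, $$\dot y(t)=f(y(t))+m\,g_{\sigma(t-t_0,\tau)}(y(t))\,\kappa_{\sigma(t-t_0,\tau)}(y(t)),\qquad y(t_0)=\bar x,\quad t\ge t_0,$$ where $$\sigma(s,\tau)=1+\left\lfloor \frac{s-m\tau\lfloor s/(m\tau)\rfloor}{\tau}\right\rfloor\in\{1,\dots,m\},\qquad s\ge 0.$$ Then the equilibrium $0\in\mathbb{R}^d$ of this scheduled system is uniformly stable, considering the switching time as a parameter. Moreover, for every $\varepsilon>0$ there exist $\delta>0$ and $\tau^*>0$, both independent of $t_0$, such that for all $\tau\in\,]0,\tau^*]$ (and all $t_0\ge 0$) the solution $y$ of the scheduled system with switching scheme $\sigma(\cdot,\tau)$ satisfies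 $$\|\bar x\|\le\delta\implies \|y(t)\|\le\varepsilon\quad\text{for all } t\ge t_0 .$$
   Context: $\|\cdot\|$ is the Euclidean norm. An equilibrium point of a system with continuously differentiable vector field is hyperbolic if the Jacobian of the vector field at that point has no eigenvalue on the imaginary axis. Uniform stability with the switching time as a parameter: the equilibrium $0$ of the scheduled system is uniformly stable if for every $\varepsilon>0$ there is a pair $(\delta,\tau)$ with $\delta>0$ and switching time $\tau>0$, both dependent only on $\varepsilon$ and independent of $t_0$, such that for the scheduled system with switching time $\tau$, $\|\bar x\|\le\delta$ implies $\|y(t)\|\le\varepsilon$ for all $t\ge t_0$. Standing assumptions: for all systems considered (the nominal closed-loop system and the scheduled systems) the right-hand side is measurable in $t$ and locally Lipschitz in the state, and (Carathéodory) solutions are unique and exist for all $t\ge t_0$. *)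

theory Defs
  imports "HOL-Analysis.Analysis"
begin

text \<open>\<open>C1_on\<close> and \<open>C2_on\<close> are meant for open \<open>S\<close>: the derivative is taken at \<open>x\<close>, not within \<open>S\<close>.\<close>

definition C1_on :: "'a::real_normed_vector set \<Rightarrow> ('a \<Rightarrow> 'b::real_normed_vector) \<Rightarrow> bool" where
  "C1_on S F \<longleftrightarrow> (\<exists>F' :: 'a \<Rightarrow> ('a \<Rightarrow>\<^sub>L 'b).
     (\<forall>x\<in>S. (F has_derivative blinfun_apply (F' x)) (at x)) \<and> continuous_on S F')"

definition C2_on :: "'a::real_normed_vector set \<Rightarrow> ('a \<Rightarrow> 'b::real_normed_vector) \<Rightarrow> bool" where
  "C2_on S F \<longleftrightarrow> (\<exists>F' :: 'a \<Rightarrow> ('a \<Rightarrow>\<^sub>L 'b).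
     (\<forall>x\<in>S. (F has_derivative blinfun_apply (F' x)) (at x)) \<and> C1_on S F')"

text \<open>Caratheodory solutions on \<open>[t0,\<infinity>)\<close> of \<open>x' = F t x\<close>, \<open>x t0 = x0\<close>, through the
  (Lebesgue) integral equation. Functions are total on the reals; the values \<open>x t\<close> with
  \<open>t < t0\<close> are irrelevant.\<close>

definition carath_solution ::
  "(real \<Rightarrow> 'a::euclidean_space \<Rightarrow> 'a) \<Rightarrow> real \<Rightarrow> 'a \<Rightarrow> (real \<Rightarrow> 'a) \<Rightarrow> bool" where
  "carath_solution F t0 x0 x \<longleftrightarrow>
     (\<forall>t\<ge>t0. (\<lambda>s. F s (x s)) absolutely_integrable_on {t0..t} \<and>
             x t = x0 + integral {t0..t} (\<lambda>s. F s (x s)))"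

text \<open>The standing assumptions on a system started at \<open>t0\<close>: measurability in time, local
  Lipschitz continuity in the state, and existence and uniqueness on \<open>[t0,\<infinity>)\<close> of the solution
  for every initial state.\<close>

definition well_posed :: "(real \<Rightarrow> 'a::euclidean_space \<Rightarrow> 'a) \<Rightarrow> real \<Rightarrow> bool" where
  "well_posed F t0 \<longleftrightarrow>
     (\<forall>x. (\<lambda>t. F t x) \<in> borel_measurable (lebesgue_on {t0..})) \<and>
     local_lipschitz {t0..} UNIV F \<and>
     (\<forall>x0. \<exists>x. carath_solution F t0 x0 x) \<and>
     (\<forall>x0 x z. carath_solution F t0 x0 x \<longrightarrow> carath_solution F t0 x0 z \<longrightarrow>
        (\<forall>t\<ge>t0. x t = z t))"

definition complex_eigenvalue :: "real^'n^'n \<Rightarrow> complex \<Rightarrow> bool" where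
  "complex_eigenvalue A \<mu> \<longleftrightarrow>
     (\<exists>v :: complex^'n. v \<noteq> 0 \<and> map_matrix complex_of_real A *v v = \<mu> *s v)"

text \<open>Continuous differentiability is only required near the equilibrium, as the feedback need
  not be differentiable elsewhere.\<close>

definition hyperbolic_equilibrium :: "(real^'n \<Rightarrow> real^'n) \<Rightarrow> real^'n \<Rightarrow> bool" where
  "hyperbolic_equilibrium F p \<longleftrightarrow>
     F p = 0 \<and> (\<exists>U. open U \<and> p \<in> U \<and> C1_on U F) \<and>
     (\<forall>\<mu>. complex_eigenvalue (jacobian F (at p)) \<mu> \<longrightarrow> Re \<mu> \<noteq> 0)"

text \<open>Since the system is autonomous, it suffices to consider the initial time \<open>0\<close>.\<close>

definition locally_asymptotically_stable :: "('a::euclidean_space \<Rightarrow> 'a) \<Rightarrow> 'a \<Rightarrow> bool" where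
  "locally_asymptotically_stable F p \<longleftrightarrow>
     F p = 0 \<and>
     (\<forall>\<epsilon>>0. \<exists>\<delta>>0. \<forall>x0 x. carath_solution (\<lambda>_. F) 0 x0 x \<longrightarrow> norm (x0 - p) \<le> \<delta> \<longrightarrow>
        (\<forall>t\<ge>0. norm (x t - p) \<le> \<epsilon>)) \<and>
     (\<exists>r>0. \<forall>x0 x. carath_solution (\<lambda>_. F) 0 x0 x \<longrightarrow> norm (x0 - p) \<le> r \<longrightarrow>
        (x \<longlongrightarrow> p) at_top)"

text \<open>The feedback is given by its components \<open>\<kappa> k\<close>; only the indices \<open>k \<in> {1..m}\<close> matter.\<close>

definition nominal ::
  "('a::real_vector \<Rightarrow> 'a) \<Rightarrow> (nat \<Rightarrow> 'a \<Rightarrow> 'a) \<Rightarrow> (nat \<Rightarrow> 'a \<Rightarrow> real) \<Rightarrow> nat \<Rightarrow> 'a \<Rightarrow> 'a" where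
  "nominal f g \<kappa> m x = f x + (\<Sum>k=1..m. \<kappa> k x *\<^sub>R g k x)"

text \<open>For \<open>m \<ge> 1\<close>, \<open>\<tau> > 0\<close> and \<open>s \<ge> 0\<close> the floor below lies in \<open>{0..<m}\<close>, so the conversion to
  \<open>nat\<close> does not truncate.\<close>

definition round_robin :: "nat \<Rightarrow> real \<Rightarrow> real \<Rightarrow> nat" where
  "round_robin m s \<tau> =
     nat (1 + \<lfloor>(s - real m * \<tau> * of_int \<lfloor>s / (real m * \<tau>)\<rfloor>) / \<tau>\<rfloor>)"

definition scheduled ::
  "('a::real_vector \<Rightarrow> 'a) \<Rightarrow> (nat \<Rightarrow> 'a \<Rightarrow> 'a) \<Rightarrow> (nat \<Rightarrow> 'a \<Rightarrow> real) \<Rightarrow> nat \<Rightarrow>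
     real \<Rightarrow> real \<Rightarrow> real \<Rightarrow> 'a \<Rightarrow> 'a" where
  "scheduled f g \<kappa> m \<tau> t0 t y =
     (let k = round_robin m (t - t0) \<tau> in f y + (real m * \<kappa> k y) *\<^sub>R g k y)"

text \<open>Uniform stability of the origin with the switching time as a parameter, for a family \<open>S \<tau> t0\<close>
  of systems, the system \<open>S \<tau> t0\<close> with switching time \<open>\<tau>\<close> being started at time \<open>t0\<close>.\<close>

definition uniformly_stable_switching ::
  "(real \<Rightarrow> real \<Rightarrow> real \<Rightarrow> 'a::euclidean_space \<Rightarrow> 'a) \<Rightarrow> bool" where
  "uniformly_stable_switching S \<longleftrightarrow>
     (\<forall>\<epsilon>>0. \<exists>\<delta>>0. \<exists>\<tau>>0. \<forall>t0\<ge>0. \<forall>x0 y. carath_solution (S \<tau> t0) t0 x0 y \<longrightarrow>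
        norm x0 \<le> \<delta> \<longrightarrow> (\<forall>t\<ge>t0. norm (y t) \<le> \<epsilon>))"

end

theory Submission
  imports Defs
begin

text \<open>
  Solutions of the nominal system are uniformly attracted: for suitable \<open>\<delta>\<close> and \<open>T\<close>, those starting in
  the \<open>\<delta>\<close>-ball stay in the \<open>\<epsilon>/2\<close>-ball and lie in the \<open>\<delta>/2\<close>-ball after time \<open>T\<close>. The nominal vector
  field is the average of the scheduled one over a round of length \<open>m \<tau>\<close>, so on a bounded time
  interval the scheduled and the nominal solution with the same initial state differ by \<open>O(\<tau>)\<close>. For
  small \<open>\<tau>\<close> the scheduled solution is therefore back in the \<open>\<delta>\<close>-ball after the first whole number of
  rounds exceeding \<open>T\<close>, without having left the \<open>\<epsilon>\<close>-ball. A new round begins there, so the argument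
  iterates.
\<close>

section \<open>Gronwall's inequality and perturbed integral equations\<close>

text \<open>The right-hand side \<open>a + L * integral {0..t} u\<close>, multiplied by
  \<open>exp (- (L * t))\<close>, has nonpositive derivative and equals \<open>a\<close> at time
  0.\<close>

lemma gronwall:
  fixes u :: "real \<Rightarrow> real"
  assumes cont: "continuous_on {0..T} u" and L: "L \<ge> 0"
    and le: "\<And>t. t \<in> {0..T} \<Longrightarrow> u t \<le> a + L * integral {0..t} u"
    and t: "t \<in> {0..T}"
  shows "u t \<le> a * exp (L * t)"
proof -
  define v where "v s = (a + L * integral {0..s} u) * exp (- (L * s))" for s
  have "v t \<le> v 0"
  proof (rule DERIV_nonpos_imp_decreasing_open[where f = v])
    show "0 \<le> t" using t by simp
  next
    fix s assume s: "0 < s" "s < t"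
    then have "at s within {0..T} = at s"
      using t by (simp add: at_within_Icc_at)
    then have "((\<lambda>x. integral {0..x} u) has_real_derivative u s) (at s)"
      using integral_has_real_derivative[OF cont, of s] s t by auto
    then have "(v has_real_derivative (L * (u s - (a + L * integral {0..s} u))) * exp (- (L * s))) (at s)"
      unfolding v_def by (auto intro!: derivative_eq_intros simp: algebra_simps)
    moreover have "(L * (u s - (a + L * integral {0..s} u))) * exp (- (L * s)) \<le> 0"
      using le[of s] s t L by (intro mult_nonpos_nonneg mult_nonneg_nonpos) auto
    ultimately show "\<exists>y. (v has_real_derivative y) (at s) \<and> y \<le> 0" by blast
  next
    have "continuous_on {0..t} u"
      using cont t by (auto intro: continuous_on_subset)
    then show "continuous_on {0..t} v"
      unfolding v_def
      by (intro continuous_intros indefinite_integral_continuous_1 integrable_continuous_real)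
  qed
  then have "a + L * integral {0..t} u \<le> a * exp (L * t)"
    by (simp add: v_def exp_minus field_simps)
  with le[OF t] show ?thesis by simp
qed

text \<open>The curves are arbitrary and \<open>c\<close> measures the defect of
  \<open>y - x\<close> in the integral equation. One estimate thus covers both a change of initial
  state (\<open>carath_solution_dependence\<close>) and a change of vector field
  (\<open>averaging_closeness\<close>).\<close>

lemma perturbation_estimate:
  fixes x y :: "real \<Rightarrow> 'a::euclidean_space"
  assumes F: "L-lipschitz_on S F"
    and x: "continuous_on {0..T} x" "x ` {0..T} \<subseteq> S"
    and y: "continuous_on {0..T} y" "y ` {0..T} \<subseteq> S"
    and c: "\<And>t. t \<in> {0..T} \<Longrightarrow>
      norm (y t - x t - integral {0..t} (\<lambda>s. F (y s) - F (x s))) \<le> c"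
    and t: "t \<in> {0..T}"
  shows "norm (y t - x t) \<le> c * exp (L * t)"
proof (rule gronwall[where u = "\<lambda>t. norm (y t - x t)" and T = T])
  have F_cont: "continuous_on S F" using F by (rule lipschitz_on_continuous_on)
  have Fy: "continuous_on {0..T} (\<lambda>s. F (y s))"
    using continuous_on_compose2[OF F_cont y] .
  have Fx: "continuous_on {0..T} (\<lambda>s. F (x s))"
    using continuous_on_compose2[OF F_cont x] .
  show "continuous_on {0..T} (\<lambda>t. norm (y t - x t))"
    by (intro continuous_intros x y)
  show "0 \<le> L" using F by (rule lipschitz_on_nonneg)
  show "t \<in> {0..T}" by fact
  fix t assume t: "t \<in> {0..T}"
  have sub: "{0..t} \<subseteq> {0..T}" using t by auto
  have "norm (integral {0..t} (\<lambda>s. F (y s) - F (x s))) \<le> integral {0..t} (\<lambda>s. L * norm (y s - x s))"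
  proof (rule integral_norm_bound_integral)
    show "(\<lambda>s. F (y s) - F (x s)) integrable_on {0..t}"
      using Fx Fy sub by (intro integrable_continuous_real continuous_intros) (auto intro: continuous_on_subset)
    show "(\<lambda>s. L * norm (y s - x s)) integrable_on {0..t}"
      using x y sub by (intro integrable_continuous_real continuous_intros) (auto intro: continuous_on_subset)
    show "norm (F (y s) - F (x s)) \<le> L * norm (y s - x s)" if "s \<in> {0..t}" for s
      using lipschitz_on_normD[OF F] x(2) y(2) sub that by blast
  qed
  also have "\<dots> = L * integral {0..t} (\<lambda>s. norm (y s - x s))" by simp
  finally show "norm (y t - x t) \<le> c + L * integral {0..t} (\<lambda>s. norm (y s - x s))"
    using c[OF t] norm_triangle_ineq[of "y t - x t - integral {0..t} (\<lambda>s. F (y s) - F (x s))"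
        "integral {0..t} (\<lambda>s. F (y s) - F (x s))"] by simp
qed

section \<open>Caratheodory solutions: increments, restarting, dependence on the initial
  state\<close>

lemma carath_solution_init: "carath_solution F t0 x0 x \<Longrightarrow> x t0 = x0"
  unfolding carath_solution_def by auto

lemma carath_solution_integrable:
  assumes "carath_solution F t0 x0 x" "t0 \<le> a"
  shows "(\<lambda>s. F s (x s)) integrable_on {a..b}"
proof (cases "a \<le> b")
  case True
  then have "(\<lambda>s. F s (x s)) absolutely_integrable_on {t0..b}"
    using assms unfolding carath_solution_def by auto
  then have "(\<lambda>s. F s (x s)) absolutely_integrable_on {a..b}"
    by (rule absolutely_integrable_on_subinterval) (use assms in auto)
  then show ?thesis using absolutely_integrable_on_def by blast
qed auto

lemma carath_solution_increment:
  assumes "carath_solution F t0 x0 x" "t0 \<le> a" "a \<le> b"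
  shows "x b = x a + integral {a..b} (\<lambda>s. F s (x s))"
proof -
  have "x b = x0 + integral {t0..b} (\<lambda>s. F s (x s))" "x a = x0 + integral {t0..a} (\<lambda>s. F s (x s))"
    using assms unfolding carath_solution_def by auto
  with Henstock_Kurzweil_Integration.integral_combine[OF assms(2,3) carath_solution_integrable[OF assms(1) order_refl]]
  show ?thesis by simp
qed

lemma carath_solution_continuous:
  assumes "carath_solution F t0 x0 x"
  shows "continuous_on {t0..T} x"
proof -
  have "continuous_on {t0..T} (\<lambda>t. x0 + integral {t0..t} (\<lambda>s. F s (x s)))"
    by (intro continuous_intros indefinite_integral_continuous_1 carath_solution_integrable[OF assms]) simp
  then show ?thesis
    by (rule continuous_on_eq) (use assms in \<open>auto simp: carath_solution_def\<close>)
qed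

text \<open>The restarted solution always begins at time 0. This allows the averaging argument to be
  carried out for initial time 0 only, which makes its constants independent of
  \<open>t0\<close>.\<close>

lemma carath_solution_restart:
  assumes "carath_solution F t0 x0 x" "t0 \<le> t1"
  shows "carath_solution (\<lambda>s. F (s + t1)) 0 (x t1) (\<lambda>s. x (s + t1))"
  unfolding carath_solution_def
proof (intro allI impI conjI)
  fix t :: real assume t: "0 \<le> t"
  have "(\<lambda>s. F s (x s)) absolutely_integrable_on {t0..t + t1}"
    using assms t unfolding carath_solution_def by auto
  then have "(\<lambda>s. F s (x s)) absolutely_integrable_on {t1..t + t1}"
    by (rule absolutely_integrable_on_subinterval) (use assms in auto)
  then have "(\<lambda>s. F s (x s)) integrable_on {t1..t + t1}"
    "(\<lambda>s. norm (F s (x s))) integrable_on {t1..t + t1}"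
    by (auto simp: absolutely_integrable_on_def)
  from this[THEN integrable_shift_real_ivl, of t1]
  show "(\<lambda>s. F (s + t1) (x (s + t1))) absolutely_integrable_on {0..t}"
    by (simp add: absolutely_integrable_on_def)
  show "x (t + t1) = x t1 + integral {0..t} (\<lambda>s. F (s + t1) (x (s + t1)))"
    using carath_solution_increment[OF assms, of "t + t1"] t
      integral_shift_real_ivl[of t1 t1 "t + t1" "\<lambda>s. F s (x s)"] by simp
qed

lemma carath_solution_dependence:
  assumes F: "L-lipschitz_on S F"
    and x: "carath_solution (\<lambda>_. F) 0 x0 x" "x ` {0..T} \<subseteq> S"
    and y: "carath_solution (\<lambda>_. F) 0 y0 y" "y ` {0..T} \<subseteq> S"
    and t: "t \<in> {0..T}"
  shows "norm (y t - x t) \<le> norm (y0 - x0) * exp (L * t)"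
proof (rule perturbation_estimate[OF F _ x(2) _ y(2) _ t])
  show "continuous_on {0..T} x" "continuous_on {0..T} y"
    using x y carath_solution_continuous by blast+
  fix t assume "t \<in> {0..T}"
  then have t: "0 \<le> t" by simp
  \<comment> \<open>By the two integral equations the vector on the left is exactly
    \<open>y0 - x0\<close>.\<close>
  show "norm (y t - x t - integral {0..t} (\<lambda>s. F (y s) - F (x s))) \<le> norm (y0 - x0)"
    using carath_solution_increment[OF x(1) order_refl t] carath_solution_increment[OF y(1) order_refl t]
      carath_solution_init[OF x(1)] carath_solution_init[OF y(1)]
      integral_diff[OF carath_solution_integrable[OF y(1) order_refl, of t]
        carath_solution_integrable[OF x(1) order_refl, of t]]
    by (simp add: algebra_simps)
qed

section \<open>Uniform attraction from local asymptotic stability\<close>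

text \<open>Asymptotic stability only gives a convergence time for each single solution. By
  continuous dependence, one time serves all initial states near a given \<open>p\<close>;
  compactness of the \<open>\<delta>\<close>-ball leaves finitely many such times; stability then
  keeps a solution that has once been small from growing again.\<close>

lemma uniform_attraction:
  fixes F :: "'a::euclidean_space \<Rightarrow> 'a"
  assumes las: "locally_asymptotically_stable F 0"
    and F: "L-lipschitz_on (cball 0 \<epsilon>) F"
    and ex: "\<And>x0. \<exists>x. carath_solution (\<lambda>_. F) 0 x0 x"
    and \<epsilon>: "\<epsilon> > 0"
  obtains \<delta> T where "\<delta> > 0" "\<delta> \<le> \<epsilon>" "T > 0"
    "\<And>x0 x t. carath_solution (\<lambda>_. F) 0 x0 x \<Longrightarrow> norm x0 \<le> \<delta> \<Longrightarrow> t \<ge> 0 \<Longrightarrow> norm (x t) \<le> \<epsilon> / 2"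
    "\<And>x0 x t. carath_solution (\<lambda>_. F) 0 x0 x \<Longrightarrow> norm x0 \<le> \<delta> \<Longrightarrow> t \<ge> T \<Longrightarrow> norm (x t) \<le> \<delta> / 2"
proof -
  let ?sol = "carath_solution (\<lambda>_. F) 0"
  have stable: "\<exists>\<delta>>0. \<forall>x0 x. ?sol x0 x \<longrightarrow> norm x0 \<le> \<delta> \<longrightarrow> (\<forall>t\<ge>0. norm (x t) \<le> e)" if "e > 0" for e
    using las that unfolding locally_asymptotically_stable_def by simp
  obtain \<delta>1 where \<delta>1: "\<delta>1 > 0" "\<And>x0 x t. ?sol x0 x \<Longrightarrow> norm x0 \<le> \<delta>1 \<Longrightarrow> t \<ge> 0 \<Longrightarrow> norm (x t) \<le> \<epsilon> / 2"
    using stable[of "\<epsilon> / 2"] \<epsilon> by auto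
  obtain r where r: "r > 0" "\<And>x0 x. ?sol x0 x \<Longrightarrow> norm x0 \<le> r \<Longrightarrow> (x \<longlongrightarrow> 0) at_top"
    using las unfolding locally_asymptotically_stable_def by auto
  define \<delta> where "\<delta> = min \<epsilon> (min \<delta>1 r)"
  have \<delta>: "\<delta> > 0" "\<delta> \<le> \<epsilon>" "\<delta> \<le> \<delta>1" "\<delta> \<le> r" using \<epsilon> \<delta>1 r by (auto simp: \<delta>_def)
  \<comment> \<open>A solution that enters the \<open>\<eta>\<close>-ball stays in the
    \<open>\<delta>/2\<close>-ball from then on, so it suffices to reach the
    \<open>\<eta>\<close>-ball once.\<close>
  obtain \<eta> where \<eta>: "\<eta> > 0" "\<And>x0 x t. ?sol x0 x \<Longrightarrow> norm x0 \<le> \<eta> \<Longrightarrow> t \<ge> 0 \<Longrightarrow> norm (x t) \<le> \<delta> / 2"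
    using stable[of "\<delta> / 2"] \<delta> by auto
  \<comment> \<open>The Lipschitz bound holds on the \<open>\<epsilon>\<close>-ball only, so
    continuous dependence needs both solutions to remain there.\<close>
  have bounded: "x ` {0..t} \<subseteq> cball 0 \<epsilon>" if "?sol x0 x" "norm x0 \<le> \<delta>" for x0 x t
    proof
    fix z assume "z \<in> x ` {0..t}"
    then have "norm z \<le> \<epsilon> / 2" using \<delta>1(2)[OF that(1)] that(2) \<delta>(3) by auto
    then show "z \<in> cball 0 \<epsilon>" using \<epsilon> by simp
  qed
  have "\<exists>d>0. \<exists>t\<ge>0. \<forall>z\<in>cball 0 \<delta> \<inter> ball p d. \<forall>x. ?sol z x \<longrightarrow> norm (x t) \<le> \<eta>" if p: "p \<in> cball 0 \<delta>" for p
  proof -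
    obtain x where x: "?sol p x" using ex by blast
    have "(x \<longlongrightarrow> 0) at_top" using r(2)[OF x] p \<delta> by simp
    then have "eventually (\<lambda>t. norm (x t) < \<eta> / 2) at_top"
      using \<eta> by (auto simp: tendsto_iff dist_norm dest: spec[of _ "\<eta> / 2"])
    then obtain t where t: "t \<ge> 0" "norm (x t) < \<eta> / 2"
      by (metis eventually_at_top_linorder linorder_linear)
    \<comment> \<open>The growth factor \<open>exp (L * t)\<close> turns a distance \<open>d\<close>
      into \<open>\<eta> / 2\<close>, and \<open>x t\<close> itself contributes less than
      \<open>\<eta> / 2\<close>.\<close>
    define d where "d = \<eta> / 2 * exp (- (L * t))"
    have "norm (y t) \<le> \<eta>" if z: "z \<in> cball 0 \<delta> \<inter> ball p d" and y: "?sol z y" for z y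
    proof -
      have "norm (y t - x t) \<le> norm (z - p) * exp (L * t)"
        using x y z p t by (intro carath_solution_dependence[OF F x bounded[OF x] y bounded[OF y], where T = t]) auto
      also have "\<dots> \<le> d * exp (L * t)"
        using z by (intro mult_right_mono) (auto simp: dist_norm norm_minus_commute)
      also have "\<dots> = \<eta> / 2" by (simp add: d_def exp_minus)
      finally show ?thesis using t norm_triangle_ineq2[of "y t" "x t"] by linarith
    qed
    moreover have "d > 0" using \<eta> by (simp add: d_def)
    ultimately show ?thesis using t(1) by blast
  qed
  then obtain d \<theta> where d: "\<And>p. p \<in> cball 0 \<delta> \<Longrightarrow> d p > 0"
    and \<theta>: "\<And>p. p \<in> cball 0 \<delta> \<Longrightarrow> \<theta> p \<ge> 0"
      "\<And>p z x. p \<in> cball 0 \<delta> \<Longrightarrow> z \<in> cball 0 \<delta> \<inter> ball p (d p) \<Longrightarrow> ?sol z x \<Longrightarrow> norm (x (\<theta> p)) \<le> \<eta>"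
    by metis
  obtain C where C: "C \<subseteq> cball 0 \<delta>" "finite C" "cball 0 \<delta> \<subseteq> (\<Union>p\<in>C. ball p (d p))"
    by (rule compactE_image[of "cball 0 \<delta> :: 'a set" "cball 0 \<delta>" "\<lambda>p. ball p (d p)"])
      (use d in auto)
  \<comment> \<open>The sum of the nonnegative times \<open>\<theta> p\<close> bounds each of them;
    the summand 1 makes \<open>T\<close> positive.\<close>
  define T where "T = 1 + (\<Sum>p\<in>C. \<theta> p)"
  have \<theta>_le: "\<theta> p \<le> T" if "p \<in> C" for p
    proof -
    have "\<theta> p \<le> (\<Sum>p\<in>C. \<theta> p)"
      using that C \<theta>(1) by (intro member_le_sum) auto
    then show ?thesis by (simp add: T_def)
  qed
  show thesis
  proof (rule that)
    show "\<delta> > 0" "\<delta> \<le> \<epsilon>" by fact+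
    show "T > 0" using C \<theta>(1) by (auto simp: T_def intro!: add_pos_nonneg sum_nonneg)
    show "norm (x t) \<le> \<epsilon> / 2" if "?sol x0 x" "norm x0 \<le> \<delta>" "t \<ge> 0" for x0 x t
      using \<delta>1(2)[OF that(1)] that \<delta> by simp
    show "norm (x t) \<le> \<delta> / 2" if x: "?sol x0 x" and x0: "norm x0 \<le> \<delta>" and t: "t \<ge> T" for x0 x t
    proof -
      obtain p where p: "p \<in> C" "x0 \<in> ball p (d p)" using C(3) x0 by auto
      then have "p \<in> cball 0 \<delta>" using C by auto
      then have "\<theta> p \<ge> 0" "norm (x (\<theta> p)) \<le> \<eta>" using \<theta> p x0 x by auto
      from \<eta>(2)[OF carath_solution_restart[OF x this(1)] this(2), of "t - \<theta> p"]
      show ?thesis using \<theta>_le[OF p(1)] t by simp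
    qed
  qed
qed

section \<open>Averaging on a bounded time interval\<close>

text \<open>With the state frozen at the start of a period, \<open>G - F\<close> integrates to zero
  over that period. Unfreezing costs \<open>O(P)\<close> pointwise, hence \<open>O(P^2)\<close> per
  period and \<open>O(P)\<close> over all complete periods. The incomplete last period adds another
  \<open>O(P)\<close>.\<close>

lemma averaging_error:
  fixes G :: "real \<Rightarrow> 'a::euclidean_space \<Rightarrow> 'a"
  assumes G: "\<And>s. L-lipschitz_on (cball 0 R) (G s)" "\<And>s. G s 0 = 0"
    and F: "L-lipschitz_on (cball 0 R) F" "F 0 = 0"
    and P: "P > 0" and R: "R \<ge> 0"
    and avg: "\<And>(j::nat) a. a \<in> cball 0 R \<Longrightarrow>
      ((\<lambda>s. G s a) has_integral P *\<^sub>R F a) {real j * P..real (Suc j) * P}"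
    and y: "carath_solution G 0 x0 y" "y ` {0..T} \<subseteq> cball 0 R"
    and t: "t \<in> {0..T}"
  shows "norm (integral {0..t} (\<lambda>s. G s (y s) - F (y s))) \<le> 2 * L * R * (L * T + 1) * P"
proof -
  have L: "L \<ge> 0" using F(1) by (rule lipschitz_on_nonneg)
  \<comment> \<open>Both fields vanish at 0, so \<open>M\<close> bounds them on the ball; it also
    bounds the speed of \<open>y\<close>.\<close>
  define M where "M = L * R"
  have M: "M \<ge> 0" using L R by (simp add: M_def)
  define h where "h s = G s (y s) - F (y s)" for s
  have yR: "y s \<in> cball 0 R" if "0 \<le> s" "s \<le> T" for s
    using y(2) that by (auto simp: image_subset_iff)
  have bound: "norm (H a) \<le> M" if "L-lipschitz_on (cball 0 R) H" "H 0 = 0" "a \<in> cball 0 R" for H :: "'a \<Rightarrow> 'a" and a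
  proof -
    have "norm (H a) \<le> L * norm a" using lipschitz_on_normD[OF that(1,3), of 0] that R by simp
    also have "\<dots> \<le> M" unfolding M_def using that L by (intro mult_left_mono) auto
    finally show ?thesis .
  qed
  have Fy: "(\<lambda>s. F (y s)) integrable_on {a..b}" if "0 \<le> a" "b \<le> T" for a b
  proof (rule integrable_continuous_real, rule continuous_on_compose2[of "cball 0 R" F _ y])
    show "continuous_on (cball 0 R) F" using F(1) by (rule lipschitz_on_continuous_on)
    show "continuous_on {a..b} y"
      using carath_solution_continuous[OF y(1), of T] by (rule continuous_on_subset) (use that in auto)
    show "y ` {a..b} \<subseteq> cball 0 R" using that by (auto intro!: yR simp del: mem_cball)
  qed
  have h: "h integrable_on {a..b}" if "0 \<le> a" "b \<le> T" for a b
    unfolding h_def using that by (intro integrable_diff Fy carath_solution_integrable[OF y(1)])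
  have h_le: "norm (h s) \<le> 2 * M" if "0 \<le> s" "s \<le> T" for s
    using bound[OF G yR[OF that], of s] bound[OF F yR[OF that]]
      norm_triangle_ineq4[of "G s (y s)" "F (y s)"] unfolding h_def by linarith
  have y_lip: "norm (y b - y a) \<le> M * (b - a)" if ab: "0 \<le> a" "a \<le> b" "b \<le> T" for a b
  proof -
    have "norm (integral {a..b} (\<lambda>s. G s (y s))) \<le> M * measure lborel {a..b}"
    proof (rule has_integral_bound_real[OF M finite.emptyI])
      show "((\<lambda>s. G s (y s)) has_integral integral {a..b} (\<lambda>s. G s (y s))) {a..b}"
        using carath_solution_integrable[OF y(1) ab(1)] by (rule integrable_integral)
      fix s assume "s \<in> {a..b} - {}"
      then show "norm (G s (y s)) \<le> M" using ab by (intro bound G yR) auto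
    qed
    then show ?thesis using carath_solution_increment[OF y(1) ab(1,2)] ab by simp
  qed
  \<comment> \<open>Within a period \<open>y\<close> moves by at most \<open>M * P\<close>, and the
    Lipschitz bounds of \<open>G\<close> and \<open>F\<close> each contribute
    \<open>L * (M * P)\<close>.\<close>
  define K where "K = 2 * L * M * P"
  have K: "K \<ge> 0" using L M P by (simp add: K_def)
  have period: "norm (integral {real j * P..real (Suc j) * P} h) \<le> K * P"
    if j: "real (Suc j) * P \<le> T" for j
  proof -
    let ?I = "{real j * P..real (Suc j) * P}"
    define a where "a = y (real j * P)"
    have jP: "0 \<le> real j * P" "real (Suc j) * P = real j * P + P"
      using P by (auto simp: algebra_simps)
    have a: "a \<in> cball 0 R" unfolding a_def using jP P j by (intro yR) auto
    have "((\<lambda>s. G s a - F a) has_integral 0) ?I"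
      using has_integral_diff[OF avg[OF a, of j] has_integral_const_real[of "F a" "real j * P" "real (Suc j) * P"]] P
      by (simp add: algebra_simps)
    from has_integral_diff[OF integrable_integral[OF h[OF jP(1) j]] this]
    have "((\<lambda>s. h s - (G s a - F a)) has_integral integral ?I h) ?I" by simp
    then have "norm (integral ?I h) \<le> K * measure lborel ?I"
    proof (rule has_integral_bound_real[OF K finite.emptyI])
      fix s assume "s \<in> ?I - {}"
      then have s: "real j * P \<le> s" "s \<le> real j * P + P" using jP by auto
      then have ys: "y s \<in> cball 0 R" using jP j by (intro yR) linarith+
        have "norm (y s - a) \<le> M * (s - real j * P)"
        unfolding a_def using s jP j by (intro y_lip) linarith+
      also have "\<dots> \<le> M * P" using s M by (intro mult_left_mono) linarith+
      finally have *: "L * norm (y s - a) \<le> L * (M * P)" using L by (intro mult_left_mono)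
      have "norm (h s - (G s a - F a)) \<le> norm (G s (y s) - G s a) + norm (F (y s) - F a)"
        using norm_triangle_ineq4[of "G s (y s) - G s a" "F (y s) - F a"] by (simp add: h_def algebra_simps)
      also have "\<dots> \<le> K"
        using lipschitz_on_normD[OF G(1) ys a, of s] lipschitz_on_normD[OF F(1) ys a] *
        unfolding K_def by linarith
      finally show "norm (h s - (G s a - F a)) \<le> K" .
    qed
    moreover have "measure lborel ?I = P" using P by (simp add: algebra_simps)
    ultimately show ?thesis by simp
  qed
  have periods: "real j * P \<le> T \<Longrightarrow> norm (integral {0..real j * P} h) \<le> K * (real j * P)" for j
  proof (induction j)
    case (Suc j)
    have jP: "0 \<le> real j * P" "real (Suc j) * P = real j * P + P"
      using P by (auto simp: algebra_simps)
    have "integral {0..real (Suc j) * P} h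
        = integral {0..real j * P} h + integral {real j * P..real (Suc j) * P} h"
      using jP P Suc.prems by (intro Henstock_Kurzweil_Integration.integral_combine[symmetric] h) auto
    moreover have "norm (integral {0..real j * P} h) \<le> K * (real j * P)"
      using Suc jP P by auto
    ultimately show ?case
      using period[OF Suc.prems]
        norm_triangle_ineq[of "integral {0..real j * P} h" "integral {real j * P..real (Suc j) * P} h"]
      by (simp add: jP algebra_simps)
  qed simp
  \<comment> \<open>The number of complete periods up to time \<open>t\<close>.\<close>
  define j where "j = nat \<lfloor>t / P\<rfloor>"
  have "real j \<le> t / P" "t / P < real j + 1"
    using t P by (auto simp: j_def)
  then have j: "real j * P \<le> t" "t \<le> real j * P + P" using P by (auto simp: field_simps)
  have jP: "0 \<le> real j * P" using P by simp
  have "norm (integral {real j * P..t} h) \<le> 2 * M * measure lborel {real j * P..t}"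
  proof (rule has_integral_bound_real[OF _ finite.emptyI integrable_integral[OF h]])
    show "0 \<le> 2 * M" "0 \<le> real j * P" "t \<le> T" using M jP t by auto
    show "norm (h s) \<le> 2 * M" if "s \<in> {real j * P..t} - {}" for s
      using that jP t by (intro h_le) auto
  qed
  also have "\<dots> \<le> 2 * M * P" using j M by (intro mult_left_mono) auto
  finally have "norm (integral {real j * P..t} h) \<le> 2 * M * P" .
  moreover have "norm (integral {0..real j * P} h) \<le> K * (real j * P)"
    using j t by (intro periods) auto
  moreover have "K * (real j * P) \<le> K * T" using j t K by (intro mult_left_mono) auto
  moreover have "integral {0..t} h = integral {0..real j * P} h + integral {real j * P..t} h"
    using jP j t by (intro Henstock_Kurzweil_Integration.integral_combine[symmetric] h) auto
  ultimately have "norm (integral {0..t} h) \<le> K * T + 2 * M * P"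
    using norm_triangle_ineq[of "integral {0..real j * P} h" "integral {real j * P..t} h"] by simp
  also have "\<dots> = 2 * L * R * (L * T + 1) * P" by (simp add: K_def M_def algebra_simps)
  finally show ?thesis unfolding h_def .
qed

text \<open>\<open>averaging_error\<close> presupposes that \<open>y\<close> stays in the
  \<open>R\<close>-ball, which is itself part of the claim. A continuity argument breaks the circle:
  while \<open>y\<close> is in the ball it is closer than \<open>R / 2\<close> to \<open>x\<close>,
  so it cannot reach the sphere of radius \<open>R\<close>.\<close>

lemma averaging_closeness:
  fixes G :: "real \<Rightarrow> 'a::euclidean_space \<Rightarrow> 'a"
  assumes G: "\<And>s. L-lipschitz_on (cball 0 R) (G s)" "\<And>s. G s 0 = 0"
    and F: "L-lipschitz_on (cball 0 R) F" "F 0 = 0"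
    and P: "P > 0" and R: "R > 0"
    and avg: "\<And>(j::nat) a. a \<in> cball 0 R \<Longrightarrow>
      ((\<lambda>s. G s a) has_integral P *\<^sub>R F a) {real j * P..real (Suc j) * P}"
    and y: "carath_solution G 0 x0 y"
    and x: "carath_solution (\<lambda>_. F) 0 x0 x" "\<And>t. t \<in> {0..T} \<Longrightarrow> norm (x t) \<le> R / 2"
    and small: "2 * L * R * (L * T + 1) * P * exp (L * T) < R / 2"
    and t: "t \<in> {0..T}"
  shows "norm (y t) \<le> R"
    and "norm (y t - x t) \<le> 2 * L * R * (L * T + 1) * P * exp (L * T)"
proof -
  have L: "L \<ge> 0" using F(1) by (rule lipschitz_on_nonneg)
  have cont: "continuous_on {0..u} y" "continuous_on {0..u} x" for u
    using carath_solution_continuous y x by blast+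
  \<comment> \<open>This bound is conditional on \<open>y\<close> staying in the ball up to time
    \<open>u\<close>; the condition is discharged once \<open>less\<close> is available.\<close>
  have est: "norm (y u - x u) \<le> 2 * L * R * (L * T + 1) * P * exp (L * T)"
    if u: "u \<in> {0..T}" and yu: "y ` {0..u} \<subseteq> cball 0 R" for u
  proof -
    let ?c = "2 * L * R * (L * u + 1) * P"
    have "norm (y u - x u) \<le> ?c * exp (L * u)"
    proof (rule perturbation_estimate[OF F(1) cont(2) _ cont(1) yu])
      show "x ` {0..u} \<subseteq> cball 0 R" using x(2) u R by fastforce
      show "u \<in> {0..u}" using u by simp
      fix v assume v: "v \<in> {0..u}"
      then have v0: "0 \<le> v" by simp
      have Fy: "(\<lambda>s. F (y s)) integrable_on {0..v}"
        using lipschitz_on_continuous_on[OF F(1)] yu v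
        by (intro integrable_continuous_real continuous_on_compose2[OF _ cont(1)]) auto
      \<comment> \<open>Equal initial states cancel, and so do the integrals of \<open>F\<close>
        along \<open>x\<close>; what remains is the averaging error along \<open>y\<close>.\<close>
      have eq: "y v - x v - integral {0..v} (\<lambda>s. F (y s) - F (x s))
          = integral {0..v} (\<lambda>s. G s (y s) - F (y s))"
        using carath_solution_increment[OF x(1) order_refl v0] carath_solution_increment[OF y order_refl v0]
          carath_solution_init[OF x(1)] carath_solution_init[OF y]
          integral_diff[OF Fy carath_solution_integrable[OF x(1) order_refl, of v]]
          integral_diff[OF carath_solution_integrable[OF y order_refl, of v] Fy]
        by (simp add: algebra_simps)
      show "norm (y v - x v - integral {0..v} (\<lambda>s. F (y s) - F (x s))) \<le> ?c"
        unfolding eq by (rule averaging_error[OF G F P less_imp_le[OF R] avg y yu v])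
    qed
    also have "\<dots> \<le> 2 * L * R * (L * T + 1) * P * exp (L * T)"
      using u L R P by (intro mult_mono mult_nonneg_nonneg add_mono mult_left_mono) (auto intro: mult_left_mono)
    finally show ?thesis .
  qed
  have reach: "\<exists>s\<in>{0..u}. norm (y s) = R" if "u \<in> {0..T}" "norm (y u) \<ge> R" for u
  proof -
    have "norm (y 0) \<le> R"
      using x(2)[of 0] that R carath_solution_init[OF x(1)] carath_solution_init[OF y] by auto
    with IVT'[of "\<lambda>s. norm (y s)" 0 R u] that cont show ?thesis
      by (force intro: continuous_on_norm)
  qed
  \<comment> \<open>At the first time \<open>s\<close> with \<open>norm (y s) = R\<close> the estimate would give \<open>norm (y s) < R\<close>.\<close>
  have never: "norm (y u) \<noteq> R" if "u \<in> {0..T}" for u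
  proof
    assume "norm (y u) = R"
    define B where "B = {u \<in> {0..T}. norm (y u) = R}"
    have "closed B" unfolding B_def
      by (intro continuous_closed_preimage_constant continuous_intros cont)
    moreover have "bounded B" by (rule bounded_subset[of "{0..T}"]) (auto simp: B_def)
    moreover have "B \<noteq> {}" using \<open>norm (y u) = R\<close> that by (auto simp: B_def)
    ultimately obtain s where s: "s \<in> B" "\<And>v. v \<in> B \<Longrightarrow> s \<le> v"
      using compact_attains_inf[of B] compact_eq_bounded_closed by blast
    have "norm (y v) \<le> R" if v: "v \<in> {0..s}" for v
    proof (rule ccontr)
      \<comment> \<open>The intermediate value theorem gives a point of \<open>B\<close> in
        \<open>{0..v}\<close>. As \<open>s\<close> is minimal in \<open>B\<close> and
        \<open>v\<close> is at most \<open>s\<close>, that point can only be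
        \<open>v\<close>.\<close>
      assume "\<not> norm (y v) \<le> R"
      then obtain w where "w \<in> {0..v}" "norm (y w) = R"
        using reach[of v] v s(1) by (auto simp: B_def)
      then have "w = v" using s(2)[of w] s(1) v by (auto simp: B_def)
      with \<open>norm (y w) = R\<close> \<open>\<not> norm (y v) \<le> R\<close> show False by simp
    qed
    then have "norm (y s - x s) < R / 2"
      using est[of s] s(1) small by (fastforce simp: B_def)
    then show False
      using s(1) x(2)[of s] norm_triangle_ineq2[of "y s" "x s"] by (auto simp: B_def)
  qed
  have less: "norm (y u) < R" if "u \<in> {0..T}" for u
    using reach[OF that] never that by (meson atLeastAtMost_iff linorder_not_le order_trans)
  show "norm (y t) \<le> R" using less[OF t] by simp
  show "norm (y t - x t) \<le> 2 * L * R * (L * T + 1) * P * exp (L * T)"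
    using t by (intro est) (auto intro!: less_imp_le[OF less])
qed

section \<open>Stability of periodic systems with small period\<close>

text \<open>The closeness estimate covers bounded time only. It is iterated over cycles of a whole
  number of periods, because after such a cycle the shifted solution solves the same system and is
  back in the \<open>\<delta>\<close>-ball.\<close>

lemma averaging_stability:
  fixes F :: "'a::euclidean_space \<Rightarrow> 'a" and G :: "real \<Rightarrow> real \<Rightarrow> 'a \<Rightarrow> 'a"
  assumes las: "locally_asymptotically_stable F 0"
    and ex: "\<And>x0. \<exists>x. carath_solution (\<lambda>_. F) 0 x0 x"
    and \<epsilon>: "\<epsilon> > 0"
    and F: "L-lipschitz_on (cball 0 \<epsilon>) F"
    and G: "\<And>P s. P > 0 \<Longrightarrow> L-lipschitz_on (cball 0 \<epsilon>) (G P s)" "\<And>P s. P > 0 \<Longrightarrow> G P s 0 = 0"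
    and periodic: "\<And>P s. P > 0 \<Longrightarrow> G P (s + P) = G P s"
    and avg: "\<And>P a. P > 0 \<Longrightarrow> a \<in> cball 0 \<epsilon> \<Longrightarrow> ((\<lambda>s. G P s a) has_integral P *\<^sub>R F a) {0..P}"
  obtains \<delta> P0 where "\<delta> > 0" "P0 > 0"
    "\<And>P x0 y t. 0 < P \<Longrightarrow> P \<le> P0 \<Longrightarrow> carath_solution (G P) 0 x0 y \<Longrightarrow> norm x0 \<le> \<delta> \<Longrightarrow> t \<ge> 0 \<Longrightarrow>
      norm (y t) \<le> \<epsilon>"
proof -
  have L: "L \<ge> 0" using F by (rule lipschitz_on_nonneg)
  have F0: "F 0 = 0" using las by (simp add: locally_asymptotically_stable_def)
  obtain \<delta> T where \<delta>: "\<delta> > 0" "\<delta> \<le> \<epsilon>" and T: "T > 0"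
    and stay: "\<And>x0 x t. carath_solution (\<lambda>_. F) 0 x0 x \<Longrightarrow> norm x0 \<le> \<delta> \<Longrightarrow> t \<ge> 0 \<Longrightarrow> norm (x t) \<le> \<epsilon> / 2"
    and attract: "\<And>x0 x t. carath_solution (\<lambda>_. F) 0 x0 x \<Longrightarrow> norm x0 \<le> \<delta> \<Longrightarrow> t \<ge> T \<Longrightarrow> norm (x t) \<le> \<delta> / 2"
    using uniform_attraction[OF las F ex \<epsilon>] by metis
  \<comment> \<open>The coefficient of \<open>P\<close> in \<open>averaging_closeness\<close>, for
    radius \<open>\<epsilon>\<close> and time horizon \<open>T + 1\<close>.\<close>
  define C where "C = 2 * L * \<epsilon> * (L * (T + 1) + 1) * exp (L * (T + 1))"
  have C: "C \<ge> 0" using L \<epsilon> T by (simp add: C_def)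
  \<comment> \<open>The bound 1 keeps a cycle within the horizon \<open>T + 1\<close>; the other
    bound gives \<open>C * P < \<delta> / 2\<close>. Using \<open>C + 1\<close> makes this
    inequality strict and avoids dividing by zero.\<close>
  define P0 where "P0 = min 1 (\<delta> / (2 * (C + 1)))"
  have P0: "P0 > 0" using \<delta> C by (simp add: P0_def)
  have "norm (y t) \<le> \<epsilon>"
    if P: "0 < P" "P \<le> P0" and y: "carath_solution (G P) 0 x0 y" "norm x0 \<le> \<delta>" and t: "t \<ge> 0" for P x0 y t
  proof -
    have "P \<le> \<delta> / (2 * (C + 1))" using P by (simp add: P0_def)
    then have "(C + 1) * P \<le> \<delta> / 2" using C by (simp add: field_simps)
    then have CP: "C * P < \<delta> / 2" using P by (simp add: algebra_simps)
    have periods: "G P (s + real j * P) = G P s" for s j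
    proof (induction j)
      case (Suc j)
      then show ?case using periodic[OF P(1), of "s + real j * P"] by (simp add: algebra_simps)
    qed simp
    have avg': "((\<lambda>s. G P s a) has_integral P *\<^sub>R F a) {real j * P..real (Suc j) * P}"
      if "a \<in> cball 0 \<epsilon>" for j a
      using has_integral_shift_real_ivl[OF avg[OF P(1) that], of "- (real j * P)"]
        periods[of "s - real j * P" j for s] by (simp add: algebra_simps)
    \<comment> \<open>The cycle length \<open>W\<close> is \<open>T\<close> rounded up to a multiple
      of \<open>P\<close>.\<close>
    define N where "N = nat \<lceil>T / P\<rceil>"
    define W where "W = real N * P"
    have "T / P > 0" using T P by simp
    then have "T / P \<le> real N" "real N < T / P + 1"
      unfolding N_def by linarith+
    then have W: "T \<le> W" "W \<le> T + P" using P by (auto simp: W_def field_simps)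
    then have W1: "W \<le> T + 1" using P by (simp add: P0_def)
    \<comment> \<open>At time \<open>W\<close> the averaged solution is in the
      \<open>\<delta>/2\<close>-ball and \<open>z\<close> is within \<open>\<delta>/2\<close> of
      it.\<close>
    have cycle: "norm (z u) \<le> \<epsilon>" "norm (z W) \<le> \<delta>"
      if z: "carath_solution (G P) 0 z0 z" and z0: "norm z0 \<le> \<delta>" and u: "0 \<le> u" "u \<le> W" for z z0 u
    proof -
      obtain x where x: "carath_solution (\<lambda>_. F) 0 z0 x" using ex by blast
      have u': "u \<in> {0..T + 1}" "W \<in> {0..T + 1}" using u W1 W T by auto
      have small: "2 * L * \<epsilon> * (L * (T + 1) + 1) * P * exp (L * (T + 1)) = C * P"
        by (simp add: C_def)
      note closeness = averaging_closeness[OF G[OF P(1)] F F0 P(1) \<epsilon> avg' z x stay[OF x z0], of "T + 1", unfolded small]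
      show "norm (z u) \<le> \<epsilon>" using CP \<delta> u' by (intro closeness) auto
      have "norm (z W - x W) \<le> C * P" using CP \<delta> u' by (intro closeness) auto
      then show "norm (z W) \<le> \<delta>"
        using attract[OF x z0 W(1)] CP norm_triangle_ineq2[of "z W" "x W"] by linarith
    qed
    have shifted: "carath_solution (G P) 0 (y (real n * W)) (\<lambda>s. y (s + real n * W))" for n
      using carath_solution_restart[OF y(1), of "real n * W"] W T periods[of _ "n * N"]
      by (simp add: W_def mult.assoc)
    have returns: "norm (y (real n * W)) \<le> \<delta>" for n
    proof (induction n)
      case 0
      then show ?case using y carath_solution_init[OF y(1)] by simp
    next
      case (Suc n)
      \<comment> \<open>The second bound of \<open>cycle\<close> does not involve \<open>u\<close>,
        so \<open>u\<close> is instantiated with the admissible value 0.\<close>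
      from cycle(2)[OF shifted this, of 0] show ?case using W T by (simp add: algebra_simps)
    qed
    define n where "n = nat \<lfloor>t / W\<rfloor>"
    have "t / W \<ge> 0" using t W T by simp
    then have "real n \<le> t / W" "t / W < real n + 1" by (auto simp: n_def)
    then have n: "real n * W \<le> t" "t \<le> real n * W + W" using W T by (auto simp: field_simps)
    from cycle(1)[OF shifted returns, of "t - real n * W" n] n show ?thesis by simp
  qed
  with \<delta> P0 show thesis using that by blast
qed

section \<open>The round-robin index and its mean over a round\<close>

text \<open>A shift by one round raises the inner floor by 1, which leaves the remainder
  unchanged.\<close>

lemma round_robin_add_period:
  assumes "m \<ge> 1" "\<tau> > 0"
  shows "round_robin m (s + real m * \<tau>) \<tau> = round_robin m s \<tau>"
proof -
  define P where "P = real m * \<tau>"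
  have "P > 0" using assms by (simp add: P_def)
  then have "\<lfloor>(s + P) / P\<rfloor> = \<lfloor>s / P\<rfloor> + 1" by (simp add: add_divide_distrib)
  then have "s + P - P * of_int \<lfloor>(s + P) / P\<rfloor> = s - P * of_int \<lfloor>s / P\<rfloor>"
    by (simp add: distrib_left)
  then show ?thesis by (simp only: round_robin_def P_def)
qed

lemma round_robin_mem:
  assumes "m \<ge> 1" "\<tau> > 0"
  shows "round_robin m s \<tau> \<in> {1..m}"
proof -
  define P where "P = real m * \<tau>"
  have P: "P > 0" using assms by (simp add: P_def)
  define q where "q = s - P * of_int \<lfloor>s / P\<rfloor>"
  have "0 \<le> q" "q < P"
    using floor_divide_lower[OF P, of s] floor_divide_upper[OF P, of s] by (auto simp: q_def algebra_simps)
  then have "0 \<le> q / \<tau>" "q / \<tau> < real m"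
    using assms by (auto simp: P_def pos_divide_less_eq)
  then have "0 \<le> \<lfloor>q / \<tau>\<rfloor>" "\<lfloor>q / \<tau>\<rfloor> < int m" by linarith+
  moreover have "round_robin m s \<tau> = nat (1 + \<lfloor>q / \<tau>\<rfloor>)"
    by (simp add: round_robin_def q_def P_def)
  ultimately show ?thesis unfolding atLeastAtMost_iff by linarith
qed

lemma round_robin_eq:
  assumes "\<tau> > 0" "i < m" "real i * \<tau> \<le> s" "s < real (Suc i) * \<tau>"
  shows "round_robin m s \<tau> = Suc i"
proof -
  have "real (Suc i) * \<tau> \<le> real m * \<tau>" using assms by (intro mult_right_mono) auto
  moreover have "0 \<le> real i * \<tau>" using assms by simp
  ultimately have "0 \<le> s" "s < real m * \<tau>" using assms by linarith+
  then have "\<lfloor>s / (real m * \<tau>)\<rfloor> = 0" using assms by (intro floor_unique) (auto simp: field_simps)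
  moreover have "\<lfloor>s / \<tau>\<rfloor> = int i" using assms by (intro floor_unique) (auto simp: field_simps)
  ultimately show ?thesis by (simp add: round_robin_def)
qed

text \<open>Stated for the first \<open>i\<close> slots of a round to permit induction; the case
  \<open>i = m\<close> gives the mean over a full round.\<close>

lemma has_integral_round_robin:
  fixes v :: "nat \<Rightarrow> 'a::euclidean_space"
  assumes "\<tau> > 0" "i \<le> m"
  shows "((\<lambda>s. v (round_robin m s \<tau>)) has_integral \<tau> *\<^sub>R (\<Sum>k=1..i. v k)) {0..real i * \<tau>}"
  using assms(2)
proof (induction i)
  case (Suc i)
  have "((\<lambda>s. v (Suc i)) has_integral \<tau> *\<^sub>R v (Suc i)) {real i * \<tau>..real (Suc i) * \<tau>}"
    using has_integral_const_real[of "v (Suc i)" "real i * \<tau>" "real (Suc i) * \<tau>"] assms(1)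
    by (simp add: algebra_simps)
  then have "((\<lambda>s. v (round_robin m s \<tau>)) has_integral \<tau> *\<^sub>R v (Suc i)) {real i * \<tau>..real (Suc i) * \<tau>}"
  \<comment> \<open>The right endpoint of a slot already belongs to the next index, but a single
    point does not affect the integral.\<close>
  proof (rule has_integral_spike_finite[of "{real (Suc i) * \<tau>}", rotated 2])
    fix s assume "s \<in> {real i * \<tau>..real (Suc i) * \<tau>} - {real (Suc i) * \<tau>}"
    then show "v (round_robin m s \<tau>) = v (Suc i)"
      using Suc.prems assms(1) by (subst round_robin_eq[of \<tau> i]) auto
  qed simp
  moreover have "((\<lambda>s. v (round_robin m s \<tau>)) has_integral \<tau> *\<^sub>R (\<Sum>k=1..i. v k)) {0..real i * \<tau>}"
    using Suc by simp
  ultimately have "((\<lambda>s. v (round_robin m s \<tau>)) has_integral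
      \<tau> *\<^sub>R (\<Sum>k=1..i. v k) + \<tau> *\<^sub>R v (Suc i)) {0..real (Suc i) * \<tau>}"
    using assms(1) by (intro has_integral_combine[of 0 "real i * \<tau>" "real (Suc i) * \<tau>"]) auto
  then show ?case by (simp add: algebra_simps)
qed (simp add: has_integral_refl)

section \<open>Application to the scheduled system\<close>

text \<open>Source of all Lipschitz constants below: the feedback itself carries no regularity
  assumption, so they are drawn from well-posedness of the systems.\<close>

lemma well_posed_lipschitz_on_compact:
  assumes wp: "well_posed F t0" and t: "t \<ge> t0" and S: "compact S"
  obtains L where "L-lipschitz_on S (F t)"
proof -
  have "local_lipschitz {t0..} UNIV F" using wp unfolding well_posed_def by blast
  then have "local_lipschitz {t} S F"
    by (rule local_lipschitz_subset) (use t in auto)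
  then obtain L where "\<And>s. s \<in> {t} \<Longrightarrow> L-lipschitz_on S (F s)"
    using local_lipschitz_compact_implies_lipschitz[OF _ S compact_sing] continuous_on_sing by blast
  with that show thesis by simp
qed

theorem theorem2p4:
  fixes f :: "real^'d \<Rightarrow> real^'d"
    and g :: "nat \<Rightarrow> real^'d \<Rightarrow> real^'d"
    and \<kappa> :: "nat \<Rightarrow> real^'d \<Rightarrow> real"
    and m :: nat
  assumes m_pos: "m \<ge> 1"
    and f_C1: "C1_on UNIV f"
    and g_C1: "\<And>k. k \<in> {1..m} \<Longrightarrow> C1_on UNIV (g k)"
    and nominal_well_posed:
      "\<And>t0. t0 \<ge> 0 \<Longrightarrow> well_posed (\<lambda>_. nominal f g \<kappa> m) t0"
    and scheduled_well_posed:
      "\<And>\<tau> t0. \<tau> > 0 \<Longrightarrow> t0 \<ge> 0 \<Longrightarrow> well_posed (scheduled f g \<kappa> m \<tau> t0) t0"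
    and hyperbolic: "hyperbolic_equilibrium (nominal f g \<kappa> m) 0"
    and asymptotically_stable: "locally_asymptotically_stable (nominal f g \<kappa> m) 0"
    and nominal_C2: "\<exists>U. open U \<and> 0 \<in> U \<and> C2_on U (nominal f g \<kappa> m)"
    and f_0: "f 0 = 0"
    and \<kappa>_0: "\<And>k. k \<in> {1..m} \<Longrightarrow> \<kappa> k 0 = 0"
  shows "(\<forall>\<tau>>0. \<forall>t0\<ge>0. \<forall>t\<ge>t0. scheduled f g \<kappa> m \<tau> t0 t 0 = 0) \<and>
    uniformly_stable_switching (scheduled f g \<kappa> m) \<and>
    (\<forall>\<epsilon>>0. \<exists>\<delta>>0. \<exists>\<tau>s>0. \<forall>\<tau>. 0 < \<tau> \<and> \<tau> \<le> \<tau>s \<longrightarrow>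
       (\<forall>t0\<ge>0. \<forall>x0 y. carath_solution (scheduled f g \<kappa> m \<tau> t0) t0 x0 y \<longrightarrow>
          norm x0 \<le> \<delta> \<longrightarrow> (\<forall>t\<ge>t0. norm (y t) \<le> \<epsilon>)))"
proof -
  \<comment> \<open>The vector field in force while index \<open>k\<close> is active.\<close>
  define H where "H k y = f y + (real m * \<kappa> k y) *\<^sub>R g k y" for k y
  define F where "F = nominal f g \<kappa> m"
  have scheduled_eq: "scheduled f g \<kappa> m \<tau> t0 t = H (round_robin m (t - t0) \<tau>)" for \<tau> t0 t
    by (rule ext) (simp add: scheduled_def H_def Let_def)
  have H0: "H k 0 = 0" if "k \<in> {1..m}" for k
    using f_0 \<kappa>_0[OF that] by (simp add: H_def)
  \<comment> \<open>The factor \<open>m\<close> in the scheduled control makes the mean of the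
    \<open>H k\<close> equal to the nominal field.\<close>
  have sum_H: "(\<Sum>k=1..m. H k y) = real m *\<^sub>R F y" for y
    by (simp add: H_def F_def nominal_def sum.distrib sum_constant_scaleR scaleR_right.sum
        scaleR_add_right del: sum_constant flip: scaleR_scaleR)
  have stability: "\<exists>\<delta>>0. \<exists>\<tau>s>0. \<forall>\<tau>. 0 < \<tau> \<and> \<tau> \<le> \<tau>s \<longrightarrow>
       (\<forall>t0\<ge>0. \<forall>x0 y. carath_solution (scheduled f g \<kappa> m \<tau> t0) t0 x0 y \<longrightarrow>
          norm x0 \<le> \<delta> \<longrightarrow> (\<forall>t\<ge>t0. norm (y t) \<le> \<epsilon>))" if \<epsilon>: "\<epsilon> > 0" for \<epsilon>
  proof -
    have "\<exists>L. L-lipschitz_on (cball 0 \<epsilon>) (H k)" if k: "k \<in> {1..m}" for k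
    proof -
      \<comment> \<open>Each \<open>H k\<close> is a snapshot of a scheduled field: with switching
        time 1 and initial time 0, index \<open>k\<close> becomes active at time
        \<open>k - 1\<close>.\<close>
      have "round_robin m (real (k - 1)) 1 = k"
        using k by (subst round_robin_eq[of 1 "k - 1"]) auto
      then have "scheduled f g \<kappa> m 1 0 (real (k - 1)) = H k"
        by (simp add: scheduled_eq)
      moreover obtain L where "L-lipschitz_on (cball 0 \<epsilon>) (scheduled f g \<kappa> m 1 0 (real (k - 1)))"
        using well_posed_lipschitz_on_compact[OF scheduled_well_posed[OF zero_less_one order_refl]
            of_nat_0_le_iff compact_cball] .
      ultimately show ?thesis by auto
    qed
    then obtain l where l: "\<And>k. k \<in> {1..m} \<Longrightarrow> (l k)-lipschitz_on (cball 0 \<epsilon>) (H k)" by metis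
    obtain l0 where l0: "l0-lipschitz_on (cball 0 \<epsilon>) F"
      using well_posed_lipschitz_on_compact[OF nominal_well_posed[OF order_refl] order_refl compact_cball]
      unfolding F_def .
    \<comment> \<open>A sum of nonnegative constants, serving \<open>F\<close> and all
      \<open>H k\<close> at once.\<close>
    define L where "L = l0 + (\<Sum>k=1..m. l k)"
    have l_nonneg: "l k \<ge> 0" if "k \<in> {1..m}" for k using l[OF that] by (rule lipschitz_on_nonneg)
    have "l0 \<ge> 0" using l0 by (rule lipschitz_on_nonneg)
    have "(\<Sum>k=1..m. l k) \<ge> 0" using l_nonneg by (rule sum_nonneg)
    then have F_lip: "L-lipschitz_on (cball 0 \<epsilon>) F"
      by (intro lipschitz_on_mono[OF l0]) (auto simp: L_def)
    have H_lip: "L-lipschitz_on (cball 0 \<epsilon>) (H k)" if k: "k \<in> {1..m}" for k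
    proof (rule lipschitz_on_mono[OF l[OF k] subset_refl])
      have "l k \<le> (\<Sum>k=1..m. l k)" using k l_nonneg by (intro member_le_sum) auto
      then show "l k \<le> L" using \<open>l0 \<ge> 0\<close> by (simp add: L_def)
    qed
    \<comment> \<open>Parametrized by the length \<open>P\<close> of a round, as
      \<open>averaging_stability\<close> expects, so the switching time is
      \<open>P / real m\<close>.\<close>
    define G where "G P s = H (round_robin m s (P / real m))" for P s
    have \<tau>: "P / real m > 0" "real m * (P / real m) = P" if "P > 0" for P
      using that m_pos by auto
    have index: "round_robin m s (P / real m) \<in> {1..m}" if "P > 0" for P s
      using m_pos \<tau>(1)[OF that] by (rule round_robin_mem)
    have las: "locally_asymptotically_stable F 0"
      using asymptotically_stable by (simp add: F_def)
    have ex: "\<exists>x. carath_solution (\<lambda>_. F) 0 x0 x" for x0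
      using nominal_well_posed[OF order_refl] unfolding well_posed_def F_def by blast
    have G_lip: "L-lipschitz_on (cball 0 \<epsilon>) (G P s)" and G0: "G P s 0 = 0" if "P > 0" for P s
      unfolding G_def by (rule H_lip[OF index[OF that]], rule H0[OF index[OF that]])
    have periodic: "G P (s + P) = G P s" if "P > 0" for P s
      using round_robin_add_period[OF m_pos \<tau>(1)[OF that], of s] by (simp only: G_def \<tau>(2)[OF that])
    have avg: "((\<lambda>s. G P s a) has_integral P *\<^sub>R F a) {0..P}" if P: "P > 0" for P a
    proof -
      have "(P / real m) *\<^sub>R (\<Sum>k=1..m. H k a) = P *\<^sub>R F a"
        using \<tau>(2)[OF P] by (simp only: sum_H scaleR_scaleR mult.commute)
      then show ?thesis
        using has_integral_round_robin[OF \<tau>(1)[OF P] order_refl[of m], where v = "\<lambda>k. H k a"]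
        by (simp only: G_def \<tau>(2)[OF P])
    qed
    obtain \<delta> P0 where \<delta>: "\<delta> > 0" and P0: "P0 > 0"
      and stable: "\<And>P x0 y t. 0 < P \<Longrightarrow> P \<le> P0 \<Longrightarrow> carath_solution (G P) 0 x0 y \<Longrightarrow> norm x0 \<le> \<delta> \<Longrightarrow> t \<ge> 0 \<Longrightarrow>
        norm (y t) \<le> \<epsilon>"
      using averaging_stability[OF las ex \<epsilon> F_lip G_lip G0 periodic avg] by metis
    have "norm (y t) \<le> \<epsilon>"
      if small: "0 < \<tau>" "\<tau> \<le> P0 / real m" and y: "carath_solution (scheduled f g \<kappa> m \<tau> t0) t0 x0 y"
        and x0: "norm x0 \<le> \<delta>" and t: "t \<ge> t0" for \<tau> t0 x0 y t
    proof -
      \<comment> \<open>The schedule depends on \<open>t - t0\<close> only, so moving the initial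
        time to 0 removes \<open>t0\<close> altogether.\<close>
      have "G (real m * \<tau>) = (\<lambda>s. scheduled f g \<kappa> m \<tau> t0 (s + t0))"
        using m_pos by (simp add: G_def scheduled_eq fun_eq_iff)
      then have "carath_solution (G (real m * \<tau>)) 0 x0 (\<lambda>s. y (s + t0))"
        using carath_solution_restart[OF y order_refl] carath_solution_init[OF y] by simp
      from stable[OF _ _ this x0, of "t - t0"] small t m_pos show ?thesis
        by (simp add: field_simps)
    qed
    moreover have "P0 / real m > 0" using P0 m_pos by simp
    ultimately show ?thesis using \<delta> by blast
  qed
  moreover have "uniformly_stable_switching (scheduled f g \<kappa> m)"
    unfolding uniformly_stable_switching_def
  proof (intro allI impI)
    fix \<epsilon> :: real assume "\<epsilon> > 0"
    from stability[OF this] obtain \<delta> \<tau>s where "\<delta> > 0" and \<tau>s: "\<tau>s > 0"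
      and *: "\<forall>\<tau>. 0 < \<tau> \<and> \<tau> \<le> \<tau>s \<longrightarrow> (\<forall>t0\<ge>0. \<forall>x0 y.
        carath_solution (scheduled f g \<kappa> m \<tau> t0) t0 x0 y \<longrightarrow>
          norm x0 \<le> \<delta> \<longrightarrow> (\<forall>t\<ge>t0. norm (y t) \<le> \<epsilon>))" by blast
    \<comment> \<open>Uniform stability asks for a single switching time; the largest one allowed is
      taken.\<close>
    from *[rule_format, of \<tau>s] \<tau>s \<open>\<delta> > 0\<close>
    show "\<exists>\<delta>>0. \<exists>\<tau>>0. \<forall>t0\<ge>0. \<forall>x0 y. carath_solution (scheduled f g \<kappa> m \<tau> t0) t0 x0 y \<longrightarrow>
        norm x0 \<le> \<delta> \<longrightarrow> (\<forall>t\<ge>t0. norm (y t) \<le> \<epsilon>)" by blast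
  qed
  moreover have "scheduled f g \<kappa> m \<tau> t0 t 0 = 0" if "\<tau> > 0" for \<tau> t0 t
    unfolding scheduled_eq by (intro H0 round_robin_mem m_pos that)
  ultimately show ?thesis by blast
qed

end
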